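(* With respect to the Hermitian form $\langle\,,\,\rangle$ on $P=\mathbb C[x,y,z,w]$, the vectors $$x^{*r}y^{*s}z^{*t}w^{*u}\qquad r,s,t,u\in\mathbb N$$ are mutually orthogonal and $$\|x^{*r}y^{*s}z^{*t}w^{*u}\|^2=r!s!t!u!\qquad r,s,t,u\in\mathbb N.$$
   Context: $\mathbb N=\{0,1,2,\ldots\}$. A Hermitian form on a complex vector space is $\mathbb C$-linear in the first argument and satisfies $\langle f,g\rangle=\overline{\langle g,f\rangle}$; $\|f\|^2=\langle f,f\rangle$. $P=\mathbb C[x,y,z,w]$ is endowed with the Hermitian form for which the monomials $x^ry^sz^tw^u$ $(r,s,t,u\in\mathbb N)$ are mutually orthogonal with $\|x^ry^sz^tw^u\|^2=r!s!t!u!$. Define $x^*=\frac{x+y+z+w}2$, $y^*=\frac{x+y-z-w}2$, $z^*=\frac{x-y+z-w}2$, $w^*=\frac{x-y-z+w}2$. *)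

theory Defs
  imports Complex_Main "HOL-Library.Poly_Mapping"
begin

datatype var = VX | VY | VZ | VW

text \<open>
  The polynomial ring in four variables over the complex numbers: finitely supported
  functions from exponent vectors to coefficients. The ring structure is the convolution
  product of \<^theory>\<open>HOL-Library.Poly_Mapping\<close>.
\<close>

type_synonym P = "(var \<Rightarrow>\<^sub>0 nat) \<Rightarrow>\<^sub>0 complex"

definition const_poly :: "complex \<Rightarrow> P" where
  "const_poly c = Poly_Mapping.single 0 c"

definition var_poly :: "var \<Rightarrow> P" where
  "var_poly v = Poly_Mapping.single (Poly_Mapping.single v 1) 1"

abbreviation "Px \<equiv> var_poly VX"
abbreviation "Py \<equiv> var_poly VY"
abbreviation "Pz \<equiv> var_poly VZ"
abbreviation "Pw \<equiv> var_poly VW"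

definition x_star :: P where "x_star = const_poly (1/2) * (Px + Py + Pz + Pw)"
definition y_star :: P where "y_star = const_poly (1/2) * (Px + Py - Pz - Pw)"
definition z_star :: P where "z_star = const_poly (1/2) * (Px - Py + Pz - Pw)"
definition w_star :: P where "w_star = const_poly (1/2) * (Px - Py - Pz + Pw)"

text \<open>Scalar multiplication on \<open>P\<close> is multiplication by constant polynomials.\<close>

definition hermitian_form :: "(P \<Rightarrow> P \<Rightarrow> complex) \<Rightarrow> bool" where
  "hermitian_form B \<longleftrightarrow>
     (\<forall>f g h. B (f + g) h = B f h + B g h) \<and>
     (\<forall>c f g. B (const_poly c * f) g = c * B f g) \<and>
     (\<forall>f g. B f g = cnj (B g f))"

definition exp_fact :: "(var \<Rightarrow>\<^sub>0 nat) \<Rightarrow> nat" where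
  "exp_fact m = fact (Poly_Mapping.lookup m VX) * fact (Poly_Mapping.lookup m VY)
              * fact (Poly_Mapping.lookup m VZ) * fact (Poly_Mapping.lookup m VW)"

text \<open>
  The form is written out in coordinates; the theorem \<open>herm_characterization\<close> below shows that
  it is the unique Hermitian form with the prescribed values on monomials.
\<close>

definition herm :: "P \<Rightarrow> P \<Rightarrow> complex" where
  "herm f g = (\<Sum>m\<in>Poly_Mapping.keys f.
     Poly_Mapping.lookup f m * cnj (Poly_Mapping.lookup g m) * of_nat (exp_fact m))"

definition expo :: "nat \<Rightarrow> nat \<Rightarrow> nat \<Rightarrow> nat \<Rightarrow> (var \<Rightarrow>\<^sub>0 nat)" where
  "expo r s t u = Poly_Mapping.single VX r + Poly_Mapping.single VY s
                + Poly_Mapping.single VZ t + Poly_Mapping.single VW u"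

lemma lookup_expo [simp]:
  "Poly_Mapping.lookup (expo r s t u) VX = r" "Poly_Mapping.lookup (expo r s t u) VY = s"
  "Poly_Mapping.lookup (expo r s t u) VZ = t" "Poly_Mapping.lookup (expo r s t u) VW = u"
  by (simp_all add: expo_def lookup_add lookup_single)

lemma expo_surj:
  "m = expo (Poly_Mapping.lookup m VX) (Poly_Mapping.lookup m VY)
            (Poly_Mapping.lookup m VZ) (Poly_Mapping.lookup m VW)"
proof (rule poly_mapping_eqI)
  fix v show "Poly_Mapping.lookup m v = Poly_Mapping.lookup (expo (Poly_Mapping.lookup m VX)
    (Poly_Mapping.lookup m VY) (Poly_Mapping.lookup m VZ) (Poly_Mapping.lookup m VW)) v"
    by (cases v) simp_all
qed

lemma expo_eq_iff [simp]:
  "expo r s t u = expo r' s' t' u' \<longleftrightarrow> (r, s, t, u) = (r', s', t', u')"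
  by (metis lookup_expo prod.inject)

lemma var_poly_power: "var_poly v ^ n = Poly_Mapping.single (Poly_Mapping.single v n) 1"
  by (induction n) (simp_all add: var_poly_def mult_single single_add[symmetric])

lemma monomial_eq: "Px ^ r * Py ^ s * Pz ^ t * Pw ^ u = Poly_Mapping.single (expo r s t u) 1"
  by (simp add: var_poly_power mult_single expo_def)

lemma lookup_const_mult:
  "Poly_Mapping.lookup (const_poly c * f) m = c * Poly_Mapping.lookup f m"
  by (simp add: const_poly_def map.rep_eq when_def flip: mult_map_scale_conv_mult)

lemma herm_superset:
  assumes "finite A" "Poly_Mapping.keys f \<subseteq> A"
  shows "herm f g = (\<Sum>m\<in>A.
     Poly_Mapping.lookup f m * cnj (Poly_Mapping.lookup g m) * of_nat (exp_fact m))"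
  unfolding herm_def using assms
  by (intro sum.mono_neutral_left) (auto simp: in_keys_iff)

lemma hermitian_form_herm: "hermitian_form herm"
  unfolding hermitian_form_def
proof (intro conjI allI)
  fix f g h :: P
  let ?A = "Poly_Mapping.keys f \<union> Poly_Mapping.keys g"
  show "herm (f + g) h = herm f h + herm g h"
    using keys_add[of f g]
    by (simp add: herm_superset[of ?A] lookup_add sum.distrib distrib_right)
next
  fix c and f g :: P
  have "Poly_Mapping.keys (const_poly c * f) \<subseteq> Poly_Mapping.keys f"
    by (auto simp: in_keys_iff lookup_const_mult)
  then show "herm (const_poly c * f) g = c * herm f g"
    by (simp add: herm_superset[of "Poly_Mapping.keys f"] lookup_const_mult sum_distrib_left mult.assoc)
next
  fix f g :: P
  let ?A = "Poly_Mapping.keys f \<union> Poly_Mapping.keys g"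
  show "herm f g = cnj (herm g f)"
    by (simp add: herm_superset[of ?A] mult.commute mult.left_commute)
qed

lemma herm_monomials:
  "herm (Px ^ r * Py ^ s * Pz ^ t * Pw ^ u) (Px ^ r' * Py ^ s' * Pz ^ t' * Pw ^ u')
     = (if (r, s, t, u) = (r', s', t', u') then of_nat (fact r * fact s * fact t * fact u) else 0)"
  by (auto simp: monomial_eq herm_def exp_fact_def lookup_single when_def)

lemma poly_expand:
  fixes f :: P
  shows "f = (\<Sum>m\<in>Poly_Mapping.keys f.
    const_poly (Poly_Mapping.lookup f m) * Poly_Mapping.single m 1)"
  by (rule poly_mapping_eqI)
     (simp add: lookup_sum lookup_const_mult lookup_single when_def in_keys_iff
        if_distrib[of "\<lambda>a. _ * a"] sum.delta cong: if_cong)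

lemma hermitian_form_sum:
  assumes "hermitian_form B"
  shows "B (\<Sum>i\<in>A. const_poly (c i) * F i) g = (\<Sum>i\<in>A. c i * B (F i) g)"
proof -
  have add: "B (p + q) g = B p g + B q g" and scale: "B (const_poly k * p) g = k * B p g" for p q k
    using assms unfolding hermitian_form_def by blast+
  have zero: "B 0 g = 0"
    using add[of 0 0] by simp
  show ?thesis
    by (induction A rule: infinite_finite_induct) (simp_all add: zero add scale)
qed

lemma hermitian_form_eqI:
  assumes B: "hermitian_form B" and C: "hermitian_form C"
    and eq: "\<And>k l. B (Poly_Mapping.single k 1) (Poly_Mapping.single l 1)
                  = C (Poly_Mapping.single k 1) (Poly_Mapping.single l 1)"
  shows "B = C"
proof -
  have left: "B' f g = (\<Sum>m\<in>Poly_Mapping.keys f.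
      Poly_Mapping.lookup f m * B' (Poly_Mapping.single m 1) g)" if "hermitian_form B'" for B' f g
    by (subst poly_expand[of f], subst hermitian_form_sum[OF that]) simp
  have swap: "B' f g = cnj (B' g f)" if "hermitian_form B'" for B' f g
    using that unfolding hermitian_form_def by blast
  have right: "B (Poly_Mapping.single m 1) g = C (Poly_Mapping.single m 1) g" for m g
  proof -
    have "B g (Poly_Mapping.single m 1) = C g (Poly_Mapping.single m 1)"
      by (subst left[OF B], subst left[OF C]) (simp add: eq)
    then show ?thesis 
      using swap[OF B, of "Poly_Mapping.single m 1" g] swap[OF C, of "Poly_Mapping.single m 1" g] by simp
  qed
  have "B f g = C f g" for f g
    by (subst left[OF B], subst left[OF C]) (simp add: right)
  then show ?thesis by blast
qed

theorem herm_characterization: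
  "B = herm \<longleftrightarrow> hermitian_form B \<and>
     (\<forall>r s t u r' s' t' u'. (r, s, t, u) \<noteq> (r', s', t', u') \<longrightarrow>
        B (Px ^ r * Py ^ s * Pz ^ t * Pw ^ u) (Px ^ r' * Py ^ s' * Pz ^ t' * Pw ^ u') = 0) \<and>
     (\<forall>r s t u. B (Px ^ r * Py ^ s * Pz ^ t * Pw ^ u) (Px ^ r * Py ^ s * Pz ^ t * Pw ^ u)
        = of_nat (fact r * fact s * fact t * fact u))"
  (is "_ \<longleftrightarrow> ?R")
proof
  assume "B = herm"
  then show ?R by (simp add: hermitian_form_herm herm_monomials del: prod.inject)
next
  assume R: ?R
  have "B (Poly_Mapping.single k 1) (Poly_Mapping.single l 1)
      = herm (Poly_Mapping.single k 1) (Poly_Mapping.single l 1)" for k l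
  proof -
    obtain r s t u where k: "k = expo r s t u" using expo_surj by blast
    obtain r' s' t' u' where l: "l = expo r' s' t' u'" using expo_surj by blast
    show ?thesis unfolding k l monomial_eq[symmetric] herm_monomials using R
      by (cases "(r, s, t, u) = (r', s', t', u')") (simp_all del: of_nat_mult)
  qed
  then show "B = herm" using R hermitian_form_herm hermitian_form_eqI by blast
qed

end

theory Submission
  imports Defs
begin

text \<open>
  For the given form, multiplication by a variable is adjoint to the partial derivative in that
  variable. Hence multiplication by a linear form with real coefficient vector \<open>a\<close> is adjoint to
  the derivative in direction \<open>a\<close>. The coefficient vectors of \<open>x\<^sup>*, y\<^sup>*, z\<^sup>*, w\<^sup>*\<close> are orthonormal, so
  these multiplications and derivatives satisfy the canonical commutation relations, and powers
  of one linear form after the other can be stripped from an inner product.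
\<close>

section \<open>Sesquilinearity of the form; constants and variables\<close>

lemma herm_add_left: "herm (f + g) h = herm f h + herm g h"
  and herm_scale_left: "herm (const_poly c * f) g = c * herm f g"
  and herm_swap: "herm f g = cnj (herm g f)"
  using hermitian_form_herm unfolding hermitian_form_def by blast+

lemma herm_add_right: "herm f (g + h) = herm f g + herm f h"
  using herm_swap[of f "g + h"] herm_swap[of f g] herm_swap[of f h] by (simp add: herm_add_left)

lemma herm_scale_right: "herm f (const_poly c * g) = cnj c * herm f g"
  using herm_swap[of f "const_poly c * g"] herm_swap[of f g] by (simp add: herm_scale_left)

lemma herm_zero_left [simp]: "herm 0 g = 0"
  by (simp add: herm_def)

lemma herm_zero_right [simp]: "herm f 0 = 0"
  by (simp add: herm_def)

lemma herm_sum_left: "herm (sum F A) g = (\<Sum>i\<in>A. herm (F i) g)"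
  by (induction A rule: infinite_finite_induct) (simp_all add: herm_add_left)

lemma herm_sum_right: "herm f (sum G A) = (\<Sum>i\<in>A. herm f (G i))"
  by (induction A rule: infinite_finite_induct) (simp_all add: herm_add_right)

lemma herm_single_left:
  "herm (Poly_Mapping.single m c) g = c * cnj (Poly_Mapping.lookup g m) * of_nat (exp_fact m)"
  by (subst herm_superset[of "{m}"]) auto

lemma const_poly_0 [simp]: "const_poly 0 = 0"
  and const_poly_1 [simp]: "const_poly 1 = 1"
  and const_poly_add: "const_poly (a + b) = const_poly a + const_poly b"
  and const_poly_mult: "const_poly (a * b) = const_poly a * const_poly b"
  and const_poly_uminus: "const_poly (- a) = - const_poly a"
  and const_poly_of_nat: "const_poly (of_nat n) = of_nat n"
  by (simp_all add: const_poly_def single_add mult_single single_uminus single_of_nat)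

lemma const_poly_sum: "const_poly (sum c A) = (\<Sum>i\<in>A. const_poly (c i))"
  by (induction A rule: infinite_finite_induct) (simp_all add: const_poly_add)

lemma var_poly_mult_single:
  "var_poly v * Poly_Mapping.single m c = Poly_Mapping.single (Poly_Mapping.single v 1 + m) c"
  by (simp add: var_poly_def mult_single)

instance var :: finite
proof
  have "(UNIV :: var set) \<subseteq> {VX, VY, VZ, VW}"
    using var.exhaust by blast
  then show "finite (UNIV :: var set)"
    by (rule finite_subset) simp
qed

lemma UNIV_var: "UNIV = {VX, VY, VZ, VW}"
  using var.exhaust by blast

lemma sum_var: "(\<Sum>v\<in>UNIV. F v) = F VX + F VY + F VZ + F VW"
  by (simp add: UNIV_var add.assoc)

section \<open>Partial derivatives as adjoints of the variables\<close>

text \<open>Given by coefficients, so that linearity is immediate: the monomial \<open>m\<close> of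
  the derivative arises only from \<open>m + single v 1\<close>. Finite support follows because this
  shift is injective.\<close>

lift_definition partial :: "var \<Rightarrow> P \<Rightarrow> P" is
  "\<lambda>v f m. f (m + Poly_Mapping.single v 1) * of_nat (Suc (Poly_Mapping.lookup m v))"
proof -
  fix v and f :: "(var \<Rightarrow>\<^sub>0 nat) \<Rightarrow> complex"
  assume "finite {m. f m \<noteq> 0}"
  then have "finite ((\<lambda>m. m + Poly_Mapping.single v 1) -` {m. f m \<noteq> 0})"
    by (rule finite_vimageI) (simp add: inj_on_def)
  then show "finite {m. f (m + Poly_Mapping.single v 1)
      * of_nat (Suc (Poly_Mapping.lookup m v)) \<noteq> 0}"
    by (rule rev_finite_subset) auto
qed

lemma partial_0 [simp]: "partial v 0 = 0"
  by (rule poly_mapping_eqI) (simp add: partial.rep_eq)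

lemma partial_add: "partial v (f + g) = partial v f + partial v g"
  by (rule poly_mapping_eqI) (simp add: partial.rep_eq lookup_add distrib_right)

lemma partial_sum: "partial v (sum F A) = (\<Sum>i\<in>A. partial v (F i))"
  by (induction A rule: infinite_finite_induct) (simp_all add: partial_add)

lemma partial_scale: "partial v (const_poly c * f) = const_poly c * partial v f"
  by (rule poly_mapping_eqI) (simp add: partial.rep_eq lookup_const_mult mult.assoc)

lemma partial_1 [simp]: "partial v 1 = 0"
proof (rule poly_mapping_eqI)
  fix m :: "var \<Rightarrow>\<^sub>0 nat"
  have "m + Poly_Mapping.single v 1 \<noteq> 0"
  proof
    assume "m + Poly_Mapping.single v 1 = 0"
    then have "Poly_Mapping.lookup (m + Poly_Mapping.single v 1) v = 0"
      by simp
    then show False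
      by (simp add: lookup_add)
  qed
  then show "Poly_Mapping.lookup (partial v 1) m = Poly_Mapping.lookup 0 m"
    by (simp add: partial.rep_eq lookup_one when_def)
qed

text \<open>Subtraction of exponents is truncated: if \<open>v\<close> does not occur in
  \<open>m\<close>, the exponent on the right is \<open>m\<close> itself, but its coefficient is
  zero.\<close>

lemma partial_single:
  "partial v (Poly_Mapping.single m c)
    = Poly_Mapping.single (m - Poly_Mapping.single v 1) (c * of_nat (Poly_Mapping.lookup m v))"
proof (rule poly_mapping_eqI)
  fix k
  show "Poly_Mapping.lookup (partial v (Poly_Mapping.single m c)) k = Poly_Mapping.lookup
    (Poly_Mapping.single (m - Poly_Mapping.single v 1) (c * of_nat (Poly_Mapping.lookup m v))) k"
  proof (cases "Poly_Mapping.lookup m v = 0")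
    case True
    then have "m \<noteq> k + Poly_Mapping.single v 1"
      by (auto simp: lookup_add)
    with True show ?thesis
      by (simp add: partial.rep_eq lookup_single when_def)
  next
    case False
    have "m - Poly_Mapping.single v 1 + Poly_Mapping.single v 1 = m"
      using False
      by (intro poly_mapping_eqI) (auto simp: lookup_add lookup_minus lookup_single when_def)
    then have iff: "m = k + Poly_Mapping.single v 1 \<longleftrightarrow> m - Poly_Mapping.single v 1 = k"
      by (metis add_diff_cancel_right')
    show ?thesis
    proof (cases "m = k + Poly_Mapping.single v 1")
      case True
      then show ?thesis
        by (simp add: partial.rep_eq lookup_add)
    next
      case False
      with iff show ?thesis
        by (simp add: partial.rep_eq lookup_single when_def)
    qed
  qed
qed

text \<open>Every polynomial is a finite sum of terms, so additive identities such as the product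
  rule and adjointness need checking only on \<open>single m c\<close>.\<close>

lemma poly_single_induct [case_names single add]:
  fixes f :: P
  assumes single: "\<And>m c. Q (Poly_Mapping.single m c)"
    and add: "\<And>f g. Q f \<Longrightarrow> Q g \<Longrightarrow> Q (f + g)"
  shows "Q f"
proof -
  have 0: "Q 0"
    using single[of 0 0] by simp
  have "Q (\<Sum>m\<in>A. const_poly (c m) * Poly_Mapping.single m 1)" for A c
    by (induction A rule: infinite_finite_induct)
       (simp_all add: 0 add single const_poly_def mult_single)
  then show ?thesis
    by (subst poly_expand[of f])
qed

lemma partial_var_mult:
  "partial v (var_poly u * f) = of_bool (u = v) * f + var_poly u * partial v f"
proof (induction f rule: poly_single_induct)
  case (add f g)
  then show ?case
    by (simp add: partial_add distrib_left)
next
  case (single m c)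
  show ?case
  proof (cases "Poly_Mapping.lookup m v = 0")
    case True
    then show ?thesis
      by (simp add: var_poly_mult_single partial_single lookup_add lookup_single when_def)
  next
    case False
    \<comment> \<open>Truncated subtraction may be regrouped here because \<open>v\<close> occurs in
      \<open>m\<close>.\<close>
    have "Poly_Mapping.single u 1 + m - Poly_Mapping.single v 1
        = Poly_Mapping.single u 1 + (m - Poly_Mapping.single v 1)"
      using False
      by (intro poly_mapping_eqI) (auto simp: lookup_add lookup_minus lookup_single when_def)
    moreover have "Poly_Mapping.single v 1 + m - Poly_Mapping.single v 1 = m"
      by simp
    ultimately show ?thesis
      by (auto simp: var_poly_mult_single partial_single lookup_add lookup_single when_def
          distrib_left single_add)
  qed
qed

lemma exp_fact_add_single:
  "exp_fact (Poly_Mapping.single v 1 + m) = Suc (Poly_Mapping.lookup m v) * exp_fact m"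
  by (cases v) (simp_all add: exp_fact_def lookup_add lookup_single when_def algebra_simps)

text \<open>On a term both sides see one coefficient of \<open>g\<close>. The factor that
  \<open>exp_fact\<close> gains when the exponent of \<open>v\<close> rises by one is exactly the
  factor produced by the derivative; this is where the factorial weights matter.\<close>

lemma herm_var_mult: "herm (var_poly v * f) g = herm f (partial v g)"
proof (induction f rule: poly_single_induct)
  case (add f h)
  then show ?case
    by (simp add: distrib_left herm_add_left)
next
  case (single m c)
  show ?case
    unfolding var_poly_mult_single herm_single_left exp_fact_add_single
    by (simp add: partial.rep_eq add.commute distrib_right)
qed

section \<open>Linear forms and directional derivatives\<close>

text \<open>Coefficients are real so that moving them to the second argument of \<open>herm\<close>
  involves no conjugation.\<close>

definition linear_form :: "(var \<Rightarrow> real) \<Rightarrow> P" where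
  "linear_form a = (\<Sum>v\<in>UNIV. const_poly (of_real (a v)) * var_poly v)"

definition dir_deriv :: "(var \<Rightarrow> real) \<Rightarrow> P \<Rightarrow> P" where
  "dir_deriv a f = (\<Sum>v\<in>UNIV. const_poly (of_real (a v)) * partial v f)"

lemma dir_deriv_1 [simp]: "dir_deriv a 1 = 0"
  by (simp add: dir_deriv_def)

lemma herm_linear_form_mult: "herm (linear_form a * f) g = herm f (dir_deriv a g)"
  by (simp add: linear_form_def dir_deriv_def sum_distrib_right mult.assoc herm_sum_left
      herm_sum_right herm_scale_left herm_scale_right herm_var_mult)

lemma dir_deriv_linear_form_mult:
  "dir_deriv a (linear_form b * f)
    = const_poly (of_real (\<Sum>v\<in>UNIV. a v * b v)) * f + linear_form b * dir_deriv a f"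
proof -
  have "dir_deriv a (linear_form b * f)
      = (\<Sum>v\<in>UNIV. \<Sum>u\<in>UNIV. const_poly (of_real (a v)) * (const_poly (of_real (b u))
          * (of_bool (u = v) * f + var_poly u * partial v f)))"
    by (simp add: dir_deriv_def linear_form_def sum_distrib_right sum_distrib_left mult.assoc
        partial_sum partial_scale partial_var_mult)
  \<comment> \<open>The factor \<open>of_bool (u = v)\<close> keeps only the diagonal of the double
    sum; the remaining terms factor as a product.\<close>
  also have "\<dots> = (\<Sum>v\<in>UNIV. const_poly (of_real (a v)) * const_poly (of_real (b v)) * f)
      + linear_form b * dir_deriv a f"
    unfolding sum_var by (simp add: linear_form_def dir_deriv_def sum_var algebra_simps)
  also have "(\<Sum>v\<in>UNIV. const_poly (of_real (a v)) * const_poly (of_real (b v)) * f)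
      = const_poly (of_real (\<Sum>v\<in>UNIV. a v * b v)) * f"
    by (simp add: const_poly_sum const_poly_mult sum_distrib_right)
  finally show ?thesis .
qed

lemma dir_deriv_orthogonal_power_mult:
  assumes "(\<Sum>v\<in>UNIV. a v * b v) = 0"
  shows "dir_deriv a (linear_form b ^ n * f) = linear_form b ^ n * dir_deriv a f"
  by (induction n) (simp_all add: mult.assoc dir_deriv_linear_form_mult assms)

lemma dir_deriv_orthogonal_power:
  assumes "(\<Sum>v\<in>UNIV. a v * b v) = 0"
  shows "dir_deriv a (linear_form b ^ n) = 0"
  using dir_deriv_orthogonal_power_mult[OF assms, of n 1] by simp

text \<open>The power rule: \<open>linear_form a\<close> has derivative 1 in its own unit direction,
  while \<open>f\<close> is constant in that direction.\<close>

lemma dir_deriv_power_mult: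
  assumes "(\<Sum>v\<in>UNIV. a v * a v) = 1" and "dir_deriv a f = 0"
  shows "dir_deriv a (linear_form a ^ Suc n * f)
    = const_poly (of_nat (Suc n)) * (linear_form a ^ n * f)"
proof (induction n)
  case 0
  show ?case
    by (simp add: dir_deriv_linear_form_mult assms)
next
  case (Suc n)
  have "dir_deriv a (linear_form a ^ Suc (Suc n) * f)
      = linear_form a ^ Suc n * f + linear_form a * dir_deriv a (linear_form a ^ Suc n * f)"
    by (simp only: power_Suc[of _ "Suc n"] mult.assoc dir_deriv_linear_form_mult assms) simp
  then show ?case
    unfolding Suc.IH const_poly_of_nat by (simp add: algebra_simps)
qed

text \<open>Adjointness turns one factor on the left into a derivative on the right, which lowers
  \<open>r'\<close> by one and contributes the old \<open>r'\<close>. Equal exponents build up the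
  factorial; otherwise a derivative finally meets \<open>f\<close> or \<open>g\<close> and kills
  it.\<close>

lemma herm_linear_form_power_mult:
  assumes a: "(\<Sum>v\<in>UNIV. a v * a v) = 1"
    and f: "dir_deriv a f = 0" and g: "dir_deriv a g = 0"
  shows "herm (linear_form a ^ r * f) (linear_form a ^ r' * g)
    = (if r = r' then fact r * herm f g else 0)"
proof (induction r arbitrary: r')
  case 0
  show ?case
  proof (cases r')
    case (Suc n)
    \<comment> \<open>With no factor left on the left, the arguments are swapped so that the
      derivative falls on \<open>f\<close>.\<close>
    have "herm (linear_form a ^ Suc n * g) f = 0"
      by (simp add: mult.assoc herm_linear_form_mult f)
    with Suc show ?thesis
      using herm_swap[of f] by simp
  qed simp
next
  case (Suc r)
  have "herm (linear_form a ^ Suc r * f) (linear_form a ^ r' * g)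
      = herm (linear_form a ^ r * f) (dir_deriv a (linear_form a ^ r' * g))"
    by (simp add: mult.assoc herm_linear_form_mult)
  also have "\<dots> = (if Suc r = r' then fact (Suc r) * herm f g else 0)"
  proof (cases r')
    case 0
    then show ?thesis by (simp add: g)
  next
    case (Suc n)
    then show ?thesis
      by (simp only: dir_deriv_power_mult[OF a g] herm_scale_right Suc.IH) simp
  qed
  finally show ?case .
qed

section \<open>The orthonormal starred variables\<close>

text \<open>Row \<open>u\<close> holds the coefficients of the starred version of \<open>u\<close>;
  the matrix is half a symmetric Hadamard matrix of order four.\<close>

definition star_coeff :: "var \<Rightarrow> var \<Rightarrow> real" where
  "star_coeff u v = (if u = VX \<or> v = VX \<or> u = v then 1/2 else - 1/2)"

lemma star_coeff_orthonormal: "(\<Sum>v\<in>UNIV. star_coeff u v * star_coeff u' v) = of_bool (u = u')"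
  unfolding sum_var by (cases u; cases u') (simp_all add: star_coeff_def)

lemma star_eq_linear_form:
  "x_star = linear_form (star_coeff VX)" "y_star = linear_form (star_coeff VY)"
  "z_star = linear_form (star_coeff VZ)" "w_star = linear_form (star_coeff VW)"
  by (simp_all add: x_star_def y_star_def z_star_def w_star_def linear_form_def sum_var
      star_coeff_def const_poly_uminus algebra_simps)

lemma herm_star_monomials:
  "herm (x_star ^ r * y_star ^ s * z_star ^ t * w_star ^ u)
        (x_star ^ r' * y_star ^ s' * z_star ^ t' * w_star ^ u')
    = (if (r, s, t, u) = (r', s', t', u') then of_nat (fact r * fact s * fact t * fact u) else 0)"
proof -
  \<comment> \<open>\<open>THEN trans\<close> reduces the norm condition to
    \<open>of_bool (u = u) = 1\<close>, which simplification discharges.\<close>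
  note strip = herm_linear_form_power_mult[OF star_coeff_orthonormal[THEN trans]]
  have "herm 1 1 = 1"
    using herm_monomials[of 0 0 0 0 0 0 0 0] by simp
  then show ?thesis
    unfolding star_eq_linear_form mult.assoc
    \<comment> \<open>The last power stands without a cofactor, so \<open>f\<close> and
      \<open>g\<close> are supplied as 1. For the earlier powers the cofactor is a product of powers
      of orthogonal forms, hence has derivative zero.\<close>
    using strip[of VW 1 1 u u']
    by (auto simp add: strip dir_deriv_orthogonal_power_mult dir_deriv_orthogonal_power
        star_coeff_orthonormal)
qed

theorem proposition9p10:
  shows "(\<forall>r s t u r' s' t' u' :: nat. (r, s, t, u) \<noteq> (r', s', t', u') \<longrightarrow>
            herm (x_star ^ r * y_star ^ s * z_star ^ t * w_star ^ u)
                 (x_star ^ r' * y_star ^ s' * z_star ^ t' * w_star ^ u') = 0) \<and>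
         (\<forall>r s t u :: nat.
            herm (x_star ^ r * y_star ^ s * z_star ^ t * w_star ^ u)
                 (x_star ^ r * y_star ^ s * z_star ^ t * w_star ^ u)
              = of_nat (fact r * fact s * fact t * fact u))"
  by (simp add: herm_star_monomials del: prod.inject)

end
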